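(* Let $D$ be a non-square positive integer, let $(\alpha,\beta)$ be the fundamental solution of $x^2-Dy^2=1$, and let $F_D=\{(x,y)\in\mathbb{Z}^2 : x^2-Dy^2=1\}$. Then for any real number $\lambda>0$, $$Q_{F_D}(\lambda)=\begin{cases}\varnothing & \text{if }\lambda<1,\\ \displaystyle\bigcup_{i,j\in\{1,-1\}}\left\{(iu(x),jv(x))\in\mathbb{Z}^2 : x\in\mathbb{Z}_{\ge 0},\ x\le\left\lfloor\frac{\log(\lfloor\lambda\rfloor)+C}{\log(\alpha+\beta\sqrt{D})}\right\rfloor\right\} & \text{if }\lambda\ge 1,\end{cases}$$ where $C=\log\left(\frac{2\sqrt{D}}{1+\sqrt{D}}\right)$ is a positive real constant. Consequently, $$|Q_{F_D}(\lambda)|=\begin{cases}0 & \text{if }\lambda<1,\\ 2+4\left\lfloor\dfrac{\log(\lfloor\lambda\rfloor)+C}{\log(\alpha+\beta\sqrt{D})}\right\rfloor & \text{if }\lambda\ge 1.\end{cases}$$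
   Context: Let $D$ be a non-square positive integer. The fundamental solution $(\alpha,\beta)$ of the Pell equation $x^2-Dy^2=1$ is the solution in positive integers with the smallest value of $x+y\sqrt{D}$ among all positive integer solutions. Define $u:[0,\infty)\to[1,\infty)$ and $v:[0,\infty)\to[0,\infty)$ by $$u(x)=\tfrac12\left\{(\alpha+\beta\sqrt{D})^x+(\alpha-\beta\sqrt{D})^x\right\},\qquad v(x)=\tfrac{1}{2\sqrt{D}}\left\{(\alpha+\beta\sqrt{D})^x-(\alpha-\beta\sqrt{D})^x\right\}.$$ For any set $G\subseteq\mathbb{Z}^2$ and real $\lambda>0$, $Q_G(\lambda):=\{(x,y)\in G : |x|+|y|\le\lambda\}$. $\lfloor\cdot\rfloor$ is the floor function and $|\cdot|$ applied to a set is its cardinality. *)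

theory Defs
  imports Complex_Main "HOL-Computational_Algebra.Nth_Powers"
begin

definition pell_solutions :: "nat \<Rightarrow> (int \<times> int) set" where
  "pell_solutions D = {(x, y). x\<^sup>2 - int D * y\<^sup>2 = 1}"

definition fundamental_solution :: "nat \<Rightarrow> int \<Rightarrow> int \<Rightarrow> bool" where
  "fundamental_solution D \<alpha> \<beta> \<longleftrightarrow>
     \<alpha> > 0 \<and> \<beta> > 0 \<and> (\<alpha>, \<beta>) \<in> pell_solutions D \<and>
     (\<forall>x y. x > 0 \<longrightarrow> y > 0 \<longrightarrow> (x, y) \<in> pell_solutions D \<longrightarrow>
        real_of_int \<alpha> + real_of_int \<beta> * sqrt D \<le> real_of_int x + real_of_int y * sqrt D)"

text \<open>
  Both bases below are positive when \<open>(\<alpha>, \<beta>)\<close> is the fundamental solution (their product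
  is 1), so \<open>powr\<close> is the usual real power. The arguments of interest are \<open>x \<ge> 0\<close>.
\<close>

definition pell_u :: "nat \<Rightarrow> int \<Rightarrow> int \<Rightarrow> real \<Rightarrow> real" where
  "pell_u D \<alpha> \<beta> x =
     1 / 2 * ((\<alpha> + \<beta> * sqrt D) powr x + (\<alpha> - \<beta> * sqrt D) powr x)"

definition pell_v :: "nat \<Rightarrow> int \<Rightarrow> int \<Rightarrow> real \<Rightarrow> real" where
  "pell_v D \<alpha> \<beta> x =
     1 / (2 * sqrt D) * ((\<alpha> + \<beta> * sqrt D) powr x - (\<alpha> - \<beta> * sqrt D) powr x)"

definition Q :: "(int \<times> int) set \<Rightarrow> real \<Rightarrow> (int \<times> int) set" where
  "Q G L = {(x, y) \<in> G. real_of_int (\<bar>x\<bar> + \<bar>y\<bar>) \<le> L}"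

definition pell_C :: "nat \<Rightarrow> real" where
  "pell_C D = ln (2 * sqrt D / (1 + sqrt D))"

definition pell_bound :: "nat \<Rightarrow> int \<Rightarrow> int \<Rightarrow> real \<Rightarrow> int" where
  "pell_bound D \<alpha> \<beta> L = \<lfloor>(ln \<lfloor>L\<rfloor> + pell_C D) / ln (\<alpha> + \<beta> * sqrt D)\<rfloor>"

end

(* Writing e = alpha + beta sqrt D, the nonnegative solutions are the pairs (u n, v n): dividing a
   solution with y > 0 by e gives a smaller nonnegative solution, since e is minimal. Furthermore
   u n + v n = (1 + sqrt D) / (2 sqrt D) e^n + r with 0 < r < 1, and both u n + v n and floor L are
   integers, so u n + v n <= L is equivalent to (1 + sqrt D) / (2 sqrt D) e^n <= floor L. *)
theory Submission
  imports Defs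
begin

locale pell_fundamental =
  fixes D :: nat and \<alpha> \<beta> :: int
  assumes nonsquare: "\<not> is_square D"
    and fundamental: "fundamental_solution D \<alpha> \<beta>"
begin

section \<open>The fundamental unit and the integer coefficients of its powers\<close>

definition eps :: real where
  "eps = \<alpha> + \<beta> * sqrt D"

text \<open>Coordinates of \<open>eps ^ n\<close> in the basis 1, \<open>sqrt D\<close> of
  \<open>Z[sqrt D]\<close>; the recursion is multiplication by \<open>eps\<close>. Working over
  \<open>int\<close> makes the integrality of u and v at natural arguments immediate.\<close>

fun power_coeffs :: "nat \<Rightarrow> int \<times> int" where
  "power_coeffs 0 = (1, 0)"
| "power_coeffs (Suc n) =
     (let (a, b) = power_coeffs n in (\<alpha> * a + int D * \<beta> * b, \<beta> * a + \<alpha> * b))"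

definition U :: "nat \<Rightarrow> int" where "U n = fst (power_coeffs n)"
definition V :: "nat \<Rightarrow> int" where "V n = snd (power_coeffs n)"

lemma U_V_0 [simp]: "U 0 = 1" "V 0 = 0"
  by (simp_all add: U_def V_def)

lemma U_V_Suc:
  "U (Suc n) = \<alpha> * U n + int D * \<beta> * V n"
  "V (Suc n) = \<beta> * U n + \<alpha> * V n"
  by (simp_all add: U_def V_def case_prod_beta Let_def)

lemma D_gt_1: "D > 1"
proof (rule ccontr)
  assume "\<not> D > 1"
  then have "D = 0\<^sup>2 \<or> D = 1\<^sup>2" by (simp; linarith)
  then have "is_square D" by (metis is_nth_power_nth_power)
  with nonsquare show False by simp
qed

lemma sqrt_D_gt_1: "sqrt D > 1"
  using D_gt_1 by simp

lemma sqrt_D_square: "sqrt D * sqrt D = real D"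
  by simp

lemma fundamental_pos: "\<alpha> > 0" "\<beta> > 0"
  using fundamental by (auto simp: fundamental_solution_def)

lemma fundamental_pell: "\<alpha>\<^sup>2 - int D * \<beta>\<^sup>2 = 1"
  using fundamental by (auto simp: fundamental_solution_def pell_solutions_def)

lemma eps_le:
  assumes "x > 0" "y > 0" "x\<^sup>2 - int D * y\<^sup>2 = 1"
  shows "eps \<le> x + y * sqrt D"
  using fundamental assms by (auto simp: fundamental_solution_def pell_solutions_def eps_def)

lemma pell_factor:
  assumes "x\<^sup>2 - int D * y\<^sup>2 = 1"
  shows "(x + y * sqrt D) * (x - y * sqrt D) = 1"
proof -
  have "(x + y * sqrt D) * (x - y * sqrt D) = real_of_int (x\<^sup>2 - int D * y\<^sup>2)"
    by (simp add: algebra_simps power2_eq_square)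
  with assms show ?thesis by simp
qed

lemma eps_gt_1: "eps > 1"
proof -
  have "real_of_int \<alpha> \<ge> 1" "real_of_int \<beta> \<ge> 1" using fundamental_pos by auto
  then have "real_of_int \<beta> * sqrt D > 0" using sqrt_D_gt_1 by (intro mult_pos_pos) auto
  then show ?thesis using \<open>real_of_int \<alpha> \<ge> 1\<close> by (simp add: eps_def)
qed

text \<open>The norm of the fundamental solution is 1, so conjugation sends \<open>eps\<close> to
  its inverse.\<close>

lemma conj_eps: "\<alpha> - \<beta> * sqrt D = inverse eps"
  using pell_factor[OF fundamental_pell] by (simp add: eps_def inverse_unique)

lemma eps_power: "U n + V n * sqrt D = eps ^ n"
proof (induction n)
  case (Suc n)
  have "U (Suc n) + V (Suc n) * sqrt D = eps * (U n + V n * sqrt D)"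
    using sqrt_D_square by (simp add: U_V_Suc eps_def algebra_simps)
  with Suc show ?case by simp
qed simp

lemma conj_eps_power: "U n - V n * sqrt D = inverse eps ^ n"
proof (induction n)
  case (Suc n)
  have "U (Suc n) - V (Suc n) * sqrt D = (\<alpha> - \<beta> * sqrt D) * (U n - V n * sqrt D)"
    using sqrt_D_square by (simp add: U_V_Suc algebra_simps)
  with Suc show ?case by (simp only: conj_eps power_Suc)
qed simp

text \<open>Bridge from real powers to the integer sequences: adding \<open>eps_power\<close> and
  \<open>conj_eps_power\<close> cancels \<open>V n\<close>; subtracting them, for
  \<open>pell_v_eq\<close>, cancels \<open>U n\<close>.\<close>

lemma pell_u_eq: "pell_u D \<alpha> \<beta> (real n) = U n"
proof -
  have "pell_u D \<alpha> \<beta> (real n) = 1 / 2 * (eps ^ n + inverse eps ^ n)"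
    using eps_gt_1 unfolding pell_u_def conj_eps
    by (simp add: eps_def[symmetric] powr_realpow)
  then show ?thesis using eps_power[of n] conj_eps_power[of n] by simp
qed

lemma pell_v_eq: "pell_v D \<alpha> \<beta> (real n) = V n"
proof -
  have "pell_v D \<alpha> \<beta> (real n) = 1 / (2 * sqrt D) * (eps ^ n - inverse eps ^ n)"
    using eps_gt_1 unfolding pell_v_def conj_eps
    by (simp add: eps_def[symmetric] powr_realpow)
  also have "eps ^ n - inverse eps ^ n = 2 * sqrt D * V n"
    unfolding eps_power[symmetric] conj_eps_power[symmetric] by simp
  finally show ?thesis using sqrt_D_gt_1 by simp
qed

lemma U_pos: "U n > 0" and V_nonneg: "V n \<ge> 0"
proof -
  have "U n > 0 \<and> V n \<ge> 0"
    by (induction n) (use fundamental_pos in \<open>auto simp: U_V_Suc intro: add_pos_nonneg\<close>)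
  then show "U n > 0" "V n \<ge> 0" by auto
qed

text \<open>The term \<open>\<beta> * U n\<close> is positive and \<alpha> is at least 1. Strictness
  lets the exponent be recovered from \<open>V n\<close>, which the count relies on.\<close>

lemma strict_mono_V: "strict_mono V"
  unfolding strict_mono_Suc_iff
proof
  fix n
  have "V n \<le> \<alpha> * V n"
    using fundamental_pos V_nonneg[of n] by (simp add: mult_le_cancel_right1)
  moreover have "\<beta> * U n > 0" using fundamental_pos U_pos[of n] by simp
  ultimately show "V n < V (Suc n)" by (simp add: U_V_Suc)
qed

lemma V_pos: "n > 0 \<Longrightarrow> V n > 0"
  using strict_monoD[OF strict_mono_V, of 0 n] by simp

text \<open>The norm form factors into conjugates, here \<open>eps ^ n\<close> and
  \<open>inverse eps ^ n\<close>.\<close>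

lemma U_V_pell: "(U n)\<^sup>2 - int D * (V n)\<^sup>2 = 1"
proof -
  have "real_of_int ((U n)\<^sup>2 - int D * (V n)\<^sup>2) = (U n + V n * sqrt D) * (U n - V n * sqrt D)"
    by (simp add: algebra_simps power2_eq_square)
  also have "\<dots> = 1"
    unfolding eps_power conj_eps_power using eps_gt_1
    by (simp add: power_mult_distrib[symmetric])
  finally show ?thesis by linarith
qed

section \<open>Classification of all solutions by descent\<close>

lemma nonneg_solution:
  assumes "x > 0" "y \<ge> 0" "x\<^sup>2 - int D * y\<^sup>2 = 1"
  shows "\<exists>n. x = U n \<and> y = V n"
  using assms
proof (induction "nat y" arbitrary: x y rule: less_induct)
  case less
  show ?case
  proof (cases "y = 0")
    case True
    then have "x = 1" using less.prems by (auto simp: power2_eq_1_iff)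
    with True show ?thesis by (intro exI[of _ 0]) simp
  next
    case False
    \<comment> \<open>These are the coefficients of
      \<open>(x + y * sqrt D) * (\<alpha> - \<beta> * sqrt D)\<close>, the quotient of the solution
      by \<open>eps\<close>.\<close>
    define x' where "x' = \<alpha> * x - int D * \<beta> * y"
    define y' where "y' = \<alpha> * y - \<beta> * x"
    define w where "w = x + y * sqrt D"
    define z where "z = w / eps"
    \<comment> \<open>Minimality of \<open>eps\<close> enters here; it applies because
      \<open>y\<close> is positive in this case.\<close>
    have z_ge: "z \<ge> 1"
      using eps_le[of x y] less.prems False eps_gt_1 by (simp add: z_def w_def)
    have "z < w"
      using eps_gt_1 z_ge by (simp add: z_def field_simps)
    have plus: "x' + y' * sqrt D = z"
    proof -
      have "x' + y' * sqrt D = (x + y * sqrt D) * (\<alpha> - \<beta> * sqrt D)"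
        using sqrt_D_square by (simp add: x'_def y'_def algebra_simps)
      then show ?thesis by (simp add: conj_eps z_def w_def divide_inverse)
    qed
    have conj_w: "x - y * sqrt D = 1 / w"
      using pell_factor[OF less.prems(3)] \<open>z < w\<close> z_ge by (simp add: w_def field_simps)
    have minus: "x' - y' * sqrt D = 1 / z"
    proof -
      have "x' - y' * sqrt D = (x - y * sqrt D) * (\<alpha> + \<beta> * sqrt D)"
        using sqrt_D_square by (simp add: x'_def y'_def algebra_simps)
      then show ?thesis by (simp add: eps_def[symmetric] conj_w z_def)
    qed
    \<comment> \<open>The sum of the conjugates \<open>z\<close> and \<open>1 / z\<close> isolates
      \<open>x'\<close>; their difference, used next, isolates \<open>y'\<close>.\<close>
    have "2 * real_of_int x' = z + 1 / z" using plus minus by linarith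
    then have "x' > 0" using z_ge by (smt (verit) divide_pos_pos of_int_pos of_int_0_less_iff)
    have "1 / z \<le> z" using z_ge by (intro order_trans[of "1 / z" 1 z]) simp_all
    then have "real_of_int y' * sqrt D \<ge> 0" using plus minus by linarith
    then have "y' \<ge> 0" using sqrt_D_gt_1 by (simp add: zero_le_mult_iff)
    \<comment> \<open>The descent is strict: passing from \<open>w\<close> to the smaller
      \<open>z\<close> decreases the value minus its reciprocal, which is twice the coefficient
      times \<open>sqrt D\<close>.\<close>
    have "1 / w < 1 / z" using \<open>z < w\<close> z_ge by (simp add: frac_less2)
    then have "real_of_int y' * sqrt D < y * sqrt D"
      using plus minus conj_w \<open>z < w\<close> w_def by linarith
    then have "y' < y" using sqrt_D_gt_1 by simp
    have "real_of_int (x'\<^sup>2 - int D * y'\<^sup>2) = (x' + y' * sqrt D) * (x' - y' * sqrt D)"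
      by (simp add: algebra_simps power2_eq_square)
    also have "\<dots> = 1" unfolding plus minus using z_ge by simp
    finally have "x'\<^sup>2 - int D * y'\<^sup>2 = 1" by linarith
    then obtain n where n: "x' = U n" "y' = V n"
      using less.hyps[of y' x'] \<open>y' < y\<close> \<open>y' \<ge> 0\<close> \<open>x' > 0\<close> by auto
    \<comment> \<open>Multiplying the quotient by \<open>eps\<close> again restores
      \<open>(x, y)\<close> up to the norm of the fundamental solution, which is 1.\<close>
    have "U (Suc n) = (\<alpha>\<^sup>2 - int D * \<beta>\<^sup>2) * x" "V (Suc n) = (\<alpha>\<^sup>2 - int D * \<beta>\<^sup>2) * y"
      by (simp_all add: U_V_Suc n[symmetric] x'_def y'_def algebra_simps power2_eq_square)
    then show ?thesis using fundamental_pell by (intro exI[of _ "Suc n"]) simp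
  qed
qed

text \<open>The equation involves only squares, so absolute values reduce it to the nonnegative
  case; a zero first coordinate would make the left side nonpositive.\<close>

lemma pell_solutions_eq:
  "pell_solutions D = {(a, b). \<exists>i\<in>{1, -1}. \<exists>j\<in>{1, -1}. \<exists>n. a = i * U n \<and> b = j * V n}"
    (is "_ = ?R")
proof (intro set_eqI iffI)
  fix p assume "p \<in> pell_solutions D"
  then obtain a b where p: "p = (a, b)" and ab: "a\<^sup>2 - int D * b\<^sup>2 = 1"
    by (auto simp: pell_solutions_def)
  have "a \<noteq> 0"
  proof
    assume "a = 0"
    with ab have "- (int D * b\<^sup>2) = 1" by simp
    moreover have "int D * b\<^sup>2 \<ge> 0" by simp
    ultimately show False by linarith
  qed
  then obtain n where n: "\<bar>a\<bar> = U n" "\<bar>b\<bar> = V n"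
    using nonneg_solution[of "\<bar>a\<bar>" "\<bar>b\<bar>"] ab by auto
  \<comment> \<open>For \<open>b = 0\<close> the sign -1 is chosen, harmlessly, since then
    \<open>V n = 0\<close>.\<close>
  have "a = (if a > 0 then 1 else -1) * U n" "b = (if b > 0 then 1 else -1) * V n"
    using n by auto
  then show "p \<in> ?R" unfolding p by fastforce
next
  fix p assume "p \<in> ?R"
  then obtain i j :: int and n where
    p: "p = (i * U n, j * V n)" and ij: "i \<in> {1, -1}" "j \<in> {1, -1}"
    by blast
  then have "(i * U n)\<^sup>2 = (U n)\<^sup>2" "(j * V n)\<^sup>2 = (V n)\<^sup>2"
    by (auto simp: power_mult_distrib)
  then show "p \<in> pell_solutions D"
    using U_V_pell[of n] by (simp add: p pell_solutions_def)
qed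

section \<open>Translating the size condition into a bound on the exponent\<close>

lemma pell_C_pos: "pell_C D > 0"
proof -
  have "1 + sqrt D > 0" "1 + sqrt D < 2 * sqrt D" using sqrt_D_gt_1 by linarith+
  then have "2 * sqrt D / (1 + sqrt D) > 1" by (simp only: less_divide_eq_1_pos)
  then show ?thesis unfolding pell_C_def by (rule ln_gt_zero)
qed

lemma pell_bound_nonneg: "L \<ge> 1 \<Longrightarrow> pell_bound D \<alpha> \<beta> L \<ge> 0"
  using pell_C_pos eps_gt_1 by (simp add: pell_bound_def eps_def[symmetric])

lemma U_plus_V_le_iff:
  assumes "L \<ge> 1"
  shows "real_of_int (U n + V n) \<le> L \<longleftrightarrow> int n \<le> pell_bound D \<alpha> \<beta> L"
proof -
  define s where "s = sqrt D"
  define N where "N = \<lfloor>L\<rfloor>"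
  \<comment> \<open>The contribution of the conjugate power to \<open>U n + V n\<close>: one half of
    it comes from \<open>U n\<close>, and \<open>1 / (2 * s)\<close> of it is subtracted by
    \<open>V n\<close>.\<close>
  define r where "r = inverse eps ^ n * (s - 1) / (2 * s)"
  have s: "s > 1" using sqrt_D_gt_1 by (simp add: s_def)
  have N: "N \<ge> 1" using assms by (simp add: N_def)
  have "0 \<le> inverse eps" "inverse eps \<le> 1" using eps_gt_1 by (auto simp: inverse_le_1_iff)
  then have "0 \<le> inverse eps ^ n" "inverse eps ^ n \<le> 1" by (simp_all add: power_le_one)
  then have "inverse eps ^ n * (s - 1) \<le> 1 * (s - 1)" using s by (intro mult_right_mono) auto
  then have "inverse eps ^ n * (s - 1) < 2 * s" by (rule le_less_trans) (use s in simp)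
  then have r: "0 \<le> r" "r < 1"
    using s \<open>0 \<le> inverse eps ^ n\<close> by (simp_all add: r_def)
  have sum: "real_of_int (U n + V n) = eps ^ n * (1 + s) / (2 * s) + r"
    unfolding r_def eps_power[symmetric] conj_eps_power[symmetric] s_def[symmetric]
    using s by (simp add: field_simps)
  have "real_of_int (U n + V n) \<le> L \<longleftrightarrow> U n + V n \<le> N"
    by (simp add: N_def le_floor_iff)
  also have "\<dots> \<longleftrightarrow> eps ^ n * (1 + s) / (2 * s) \<le> N"
  proof
    assume "U n + V n \<le> N"
    then have "real_of_int (U n + V n) \<le> real_of_int N" by (simp only: of_int_le_iff)
    then show "eps ^ n * (1 + s) / (2 * s) \<le> N" using sum r by linarith
  next
    assume "eps ^ n * (1 + s) / (2 * s) \<le> N"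
    \<comment> \<open>Since \<open>r < 1\<close>, the integer \<open>U n + V n\<close> lies strictly
      below \<open>N + 1\<close>, so dropping \<open>r\<close> loses nothing.\<close>
    then have "real_of_int (U n + V n) < real_of_int (N + 1)" using sum r by simp
    then show "U n + V n \<le> N" by linarith
  qed
  \<comment> \<open>The factor \<open>2 * s / (1 + s)\<close> is the exponential of
    \<open>pell_C D\<close>; taking logarithms makes the condition linear in
    \<open>n\<close>.\<close>
  also have "\<dots> \<longleftrightarrow> eps ^ n \<le> N * (2 * s / (1 + s))"
    using s by (simp add: field_simps)
  also have "\<dots> \<longleftrightarrow> ln (eps ^ n) \<le> ln (N * (2 * s / (1 + s)))"
    using s N eps_gt_1 by (intro ln_le_cancel_iff[symmetric] mult_pos_pos) auto
  also have "ln (N * (2 * s / (1 + s))) = ln N + pell_C D"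
    unfolding pell_C_def s_def[symmetric] using s N by (intro ln_mult_pos) auto
  also have "ln (eps ^ n) = n * ln eps"
    using eps_gt_1 by (simp add: ln_realpow)
  also have "n * ln eps \<le> ln N + pell_C D \<longleftrightarrow> n \<le> (ln N + pell_C D) / ln eps"
    using eps_gt_1 by (simp add: pos_le_divide_eq)
  also have "\<dots> \<longleftrightarrow> int n \<le> pell_bound D \<alpha> \<beta> L"
    by (simp add: pell_bound_def eps_def[symmetric] N_def le_floor_iff)
  finally show ?thesis .
qed

section \<open>The solutions of bounded size and their number\<close>

lemma Q_less_1:
  assumes "L < 1"
  shows "Q (pell_solutions D) L = {}"
proof -
  have False if "(a, b) \<in> pell_solutions D" "real_of_int (\<bar>a\<bar> + \<bar>b\<bar>) \<le> L" for a b
  proof -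
    have "\<bar>a\<bar> + \<bar>b\<bar> < 1" using that(2) assms by linarith
    \<comment> \<open>Only the origin has size below 1, and it does not solve the equation.\<close>
    then have "a = 0" "b = 0" by linarith+
    with that(1) show False by (simp add: pell_solutions_def)
  qed
  then show ?thesis by (auto simp: Q_def)
qed

text \<open>Sign changes preserve the size, so the size condition restricts only the
  exponent.\<close>

lemma Q_ge_1:
  assumes "L \<ge> 1"
  shows "Q (pell_solutions D) L =
    {(a, b). \<exists>i\<in>{1, -1}. \<exists>j\<in>{1, -1}. \<exists>n. int n \<le> pell_bound D \<alpha> \<beta> L
       \<and> a = i * U n \<and> b = j * V n}"
proof -
  have "\<bar>i * U n\<bar> + \<bar>j * V n\<bar> = U n + V n" if "i \<in> {1, -1}" "j \<in> {1, -1}" for i j n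
    using that U_pos[of n] V_nonneg[of n] by auto
  then have "real_of_int (\<bar>i * U n\<bar> + \<bar>j * V n\<bar>) \<le> L \<longleftrightarrow> int n \<le> pell_bound D \<alpha> \<beta> L"
    if "i \<in> {1, -1}" "j \<in> {1, -1}" for i j n
    using that U_plus_V_le_iff[OF assms, of n] by metis
  then show ?thesis
    unfolding Q_def pell_solutions_eq by blast
qed

text \<open>Exponent 0 contributes two points, as \<open>V 0 = 0\<close> absorbs the second sign;
  each exponent from 1 to the bound contributes four.\<close>

lemma card_Q_ge_1:
  assumes "L \<ge> 1"
  shows "int (card (Q (pell_solutions D) L)) = 2 + 4 * pell_bound D \<alpha> \<beta> L"
proof -
  define K where "K = nat (pell_bound D \<alpha> \<beta> L)"
  have K: "int K = pell_bound D \<alpha> \<beta> L"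
    using pell_bound_nonneg[OF assms] by (simp add: K_def)
  \<comment> \<open>Exponents start at 1 because at 0 the two choices of \<open>j\<close> give the
    same point.\<close>
  define I where "I = {1, -1 :: int} \<times> {1, -1 :: int} \<times> {1..K}"
  define f where "f = (\<lambda>(i, j, n). (i * U n, j * V n))"
  have "Q (pell_solutions D) L = {(1, 0), (-1, 0)} \<union> f ` I"
  proof (intro equalityI subsetI)
    fix p assume "p \<in> Q (pell_solutions D) L"
    then obtain i j n where ij: "i \<in> {1, -1}" "j \<in> {1, -1}" and "int n \<le> int K"
      and p: "p = (i * U n, j * V n)"
      unfolding Q_ge_1[OF assms] K by blast
    show "p \<in> {(1, 0), (-1, 0)} \<union> f ` I"
    proof (cases "n = 0")
      case True
      then show ?thesis using ij p by auto
    next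
      case False
      then have "(i, j, n) \<in> I" using ij \<open>int n \<le> int K\<close> by (auto simp: I_def)
      moreover have "p = f (i, j, n)" by (simp add: f_def p)
      ultimately show ?thesis by blast
    qed
  next
    fix p assume "p \<in> {(1, 0), (-1, 0)} \<union> f ` I"
    then have "\<exists>i\<in>{1, -1}. \<exists>j\<in>{1, -1}. \<exists>n. int n \<le> int K \<and> p = (i * U n, j * V n)"
    proof
      assume "p \<in> {(1, 0), (-1, 0)}"
      then show ?thesis by (auto intro!: exI[of _ 0])
    next
      assume "p \<in> f ` I"
      then obtain i j n where "(i, j, n) \<in> I" "p = f (i, j, n)" by auto
      then have "i \<in> {1, -1}" "j \<in> {1, -1}" "int n \<le> int K" "p = (i * U n, j * V n)"
        by (simp_all add: I_def f_def)
      then show ?thesis by blast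
    qed
    then show "p \<in> Q (pell_solutions D) L"
      unfolding Q_ge_1[OF assms] K[symmetric] by blast
  qed
  moreover have "inj_on f I"
  proof (rule inj_onI)
    fix p q assume pq: "p \<in> I" "q \<in> I" "f p = f q"
    obtain i j n where p: "p = (i, j, n)" by (cases p)
    obtain i' j' n' where q: "q = (i', j', n')" by (cases q)
    have eq: "i * U n = i' * U n'" "j * V n = j' * V n'" using pq(3) by (simp_all add: f_def p q)
    have "V n > 0" "V n' > 0" using pq by (auto simp: I_def p q intro: V_pos)
    moreover have "j \<in> {1, -1}" "j' \<in> {1, -1}" using pq by (auto simp: I_def p q)
    \<comment> \<open>Positivity of \<open>V\<close> separates the sign from the absolute value;
      strict monotonicity then gives the exponent.\<close>
    ultimately have "j = j'" "V n = V n'" using eq(2) by auto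
    then have "n = n'" using strict_mono_eq[OF strict_mono_V] by blast
    then have "i = i'" using eq(1) U_pos[of n'] by simp
    with \<open>j = j'\<close> \<open>n = n'\<close> show "p = q" by (simp add: p q)
  qed
  moreover have "{(1, 0), (-1, 0)} \<inter> f ` I = {}"
  proof -
    \<comment> \<open>The second coordinate tells the two sets apart: it vanishes only for exponent
      0.\<close>
    have "snd p \<noteq> 0" if "p \<in> f ` I" for p
    proof -
      from that obtain i j n where "(i, j, n) \<in> I" "p = f (i, j, n)" by auto
      then show ?thesis using V_pos[of n] by (auto simp: I_def f_def)
    qed
    from this[of "(1, 0)"] this[of "(-1, 0)"] show ?thesis by auto
  qed
  moreover have "finite I" "card I = 4 * K"
    by (simp_all add: I_def card_cartesian_product)
  ultimately have "card (Q (pell_solutions D) L) = 2 + 4 * K"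
    by (simp add: card_Un_disjoint card_image)
  then show ?thesis using K by simp
qed

end

theorem corollary2p4:
  fixes D :: nat and \<alpha> \<beta> :: int and L :: real
  assumes "D > 0" and "\<not> is_square D"
    and "fundamental_solution D \<alpha> \<beta>"
    and "L > 0"
  shows "pell_C D > 0
    \<and> Q (pell_solutions D) L =
        (if L < 1 then {}
         else (\<Union>i\<in>{1, -1 :: int}. \<Union>j\<in>{1, -1 :: int}.
                 {(a, b). \<exists>x :: nat. int x \<le> pell_bound D \<alpha> \<beta> L
                    \<and> real_of_int a = real_of_int i * pell_u D \<alpha> \<beta> (real x)
                    \<and> real_of_int b = real_of_int j * pell_v D \<alpha> \<beta> (real x)}))
    \<and> int (card (Q (pell_solutions D) L)) =
        (if L < 1 then 0 else 2 + 4 * pell_bound D \<alpha> \<beta> L)"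
proof -
  interpret pell_fundamental D \<alpha> \<beta> using assms by unfold_locales
  show ?thesis
  proof (cases "L < 1")
    case True
    then show ?thesis using pell_C_pos Q_less_1 by simp
  next
    case False
    then have L: "L \<ge> 1" by simp
    have "Q (pell_solutions D) L = (\<Union>i\<in>{1, -1 :: int}. \<Union>j\<in>{1, -1 :: int}.
                 {(a, b). \<exists>x :: nat. int x \<le> pell_bound D \<alpha> \<beta> L
                    \<and> real_of_int a = real_of_int i * pell_u D \<alpha> \<beta> (real x)
                    \<and> real_of_int b = real_of_int j * pell_v D \<alpha> \<beta> (real x)})"
      \<comment> \<open>At natural arguments u and v are integers, so injectivity of
        \<open>of_int\<close> turns the real equations into the integer ones of
        \<open>Q_ge_1\<close>.\<close>
      unfolding Q_ge_1[OF L] pell_u_eq pell_v_eq of_int_mult[symmetric] of_int_eq_iff by blast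
    then show ?thesis using False pell_C_pos card_Q_ge_1[OF L] by simp
  qed
qed

end
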